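(* Consider an $n$-player game ($n\ge 4$) with two groups $G_1=\{1,\dots,m\}$ and $G_2=\{m+1,\dots,n\}$, $2\le m\le n-2$, which is zero-sum and symmetric in each group and satisfies all the standing assumptions listed in the context. Suppose that the game has a Nash equilibrium which is symmetric in each group, i.e. a Nash equilibrium of the form $(s^*,\dots,s^*,s^{**},\dots,s^{**})$ in which every player in $G_1$ chooses $s^*\in S$ and every player in $G_2$ chooses $s^{**}\in S'$. Then Sion's minimax theorem with the coincidence of the maximin strategy and the minimax strategy holds in each group, i.e. there exist $\tilde s\in S$ and $\hat s\in S'$ such that for all distinct $i,j\in G_1$ and all distinct $k,l\in G_2$: $$\max_{s_i\in S}\min_{s_j\in S}u_i(s_i,s_j,\tilde s,\dots,\tilde s,\hat s,\dots,\hat s)=\min_{s_j\in S}\max_{s_i\in S}u_i(s_i,s_j,\tilde s,\dots,\tilde s,\hat s,\dots,\hat s),$$ $$\tilde s=\arg\max_{s_i\in S}\min_{s_j\in S}u_i(s_i,s_j,\tilde s,\dots,\tilde s,\hat s,\dots,\hat s)=\arg\min_{s_j\in S}\max_{s_i\in S}u_i(s_i,s_j,\tilde s,\dots,\tilde s,\hat s,\dots,\hat s),$$ $$\max_{s_k\in S'}\min_{s_l\in S'}u_k(\tilde s,\dots,\tilde s,s_k,s_l,\hat s,\dots,\hat s)=\min_{s_l\in S'}\max_{s_k\in S'}u_k(\tilde s,\dots,\tilde s,s_k,s_l,\hat s,\dots,\hat s),$$ $$\hat s=\arg\max_{s_k\in S'}\min_{s_l\in S'}u_k(\tilde s,\dots,\tilde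 s,s_k,s_l,\hat s,\dots,\hat s)=\arg\min_{s_l\in S'}\max_{s_k\in S'}u_k(\tilde s,\dots,\tilde s,s_k,s_l,\hat s,\dots,\hat s).$$
   Context: Game. There are $n\ge 4$ players, divided into $G_1=\{1,\dots,m\}$ and $G_2=\{m+1,\dots,n\}$ with $2\le m\le n-2$. Player $i$ has strategy set $S_i$, a nonempty convex compact subset of a linear topological space, and payoff function $u_i:S_1\times\cdots\times S_n\to\mathbb{R}$. Players in the same group have the same strategy set: $S_i=S$ for $i\in G_1$ and $S_k=S'$ for $k\in G_2$. Standing assumptions. (1) Each $u_i$ is continuous on $S_1\times\cdots\times S_n$, quasi-concave in $s_i$ for any fixed strategies of the other players, and, for each $j\ne i$, quasi-convex in $s_j$ for any fixed strategies of the players other than $j$. (2) Zero-sum in each group: $\sum_{i\in G_1}u_i(s_1,\dots,s_n)=0$ and $\sum_{k\in G_2}u_k(s_1,\dots,s_n)=0$ for every $(s_1,\dots,s_n)$. (3) Symmetric in each group (players in a group have the same payoff functions): for every permutation $\pi$ of $\{1,\dots,n\}$ with $\pi(G_1)=G_1$ and $\pi(G_2)=G_2$, every player $i$ and every profile $(s_1,\dots,s_n)$, $u_{\pi(i)}(s_1,\dots,s_n)=u_i(s_{\pi(1)},\dots,s_{\pi(n)})$. (4) Uniqueness: for any distinct $i,j$ in the same group and any fixed strategies of all players other than $i,j$, the set $\arg\max_{s_i}\min_{s_j}u_i$ (maximin strategy) and the set $\arg\min_{s_j}\max_{s_i}u_i$ (minimax strategy) are singletons, and are identified with their unique element; likewise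 for any player $i$ and any fixed strategies of the others, the best response $\arg\max_{s_i}u_i$ is unique. Notation. $(s_i,s_j,\tilde s,\dots,\tilde s,\hat s,\dots,\hat s)$ is the profile in which players $i,j\in G_1$ choose $s_i,s_j$, all other players in $G_1$ choose $\tilde s$, and all players in $G_2$ choose $\hat s$. $(\tilde s,\dots,\tilde s,s_k,s_l,\hat s,\dots,\hat s)$ is the profile in which all players in $G_1$ choose $\tilde s$, players $k,l\in G_2$ choose $s_k,s_l$, and all other players in $G_2$ choose $\hat s$. A Nash equilibrium is a profile $(s_1^*,\dots,s_n^* )$ such that for every player $i$ and every $s_i\in S_i$, $u_i(s_1^*,\dots,s_i^*,\dots,s_n^* )\ge u_i(s_1^*,\dots,s_i,\dots,s_n^* )$. *)

theory Defs
  imports "HOL-Analysis.Analysis"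
begin

(* Linear topological spaces. The Hausdorff property is not part of the notion. *)
class topological_vector_space = real_vector + topological_ab_group_add +
  assumes tendsto_scaleR_Pair: "LIM p (nhds c \<times>\<^sub>F nhds a). fst p *\<^sub>R snd p :> nhds (c *\<^sub>R a)"

instance real_normed_vector < topological_vector_space
proof
  fix c :: real and a :: 'a
  show "LIM p (nhds c \<times>\<^sub>F nhds a). fst p *\<^sub>R snd p :> nhds (c *\<^sub>R a)"
    by (intro tendsto_scaleR filterlim_fst filterlim_snd)
qed

definition quasi_concave_on :: "'s::real_vector set \<Rightarrow> ('s \<Rightarrow> real) \<Rightarrow> bool" where
  "quasi_concave_on A f \<longleftrightarrow> (\<forall>c. convex {s \<in> A. c \<le> f s})"

definition quasi_convex_on :: "'s::real_vector set \<Rightarrow> ('s \<Rightarrow> real) \<Rightarrow> bool" where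
  "quasi_convex_on A f \<longleftrightarrow> (\<forall>c. convex {s \<in> A. f s \<le> c})"

(* max_on and min_on are the attained maximum and minimum, not Sup and Inf; they are
   meaningful only where an extremum exists (e.g. f continuous, A compact and nonempty). *)
definition max_on :: "'s set \<Rightarrow> ('s \<Rightarrow> real) \<Rightarrow> real" where
  "max_on A f = (GREATEST v. v \<in> f ` A)"

definition min_on :: "'s set \<Rightarrow> ('s \<Rightarrow> real) \<Rightarrow> real" where
  "min_on A f = (LEAST v. v \<in> f ` A)"

(* The full sets of maximisers and minimisers (arg_max and arg_min choose one element). *)
definition argmax_on :: "'s set \<Rightarrow> ('s \<Rightarrow> real) \<Rightarrow> 's set" where
  "argmax_on A f = {s. is_arg_max f (\<lambda>s. s \<in> A) s}"

definition argmin_on :: "'s set \<Rightarrow> ('s \<Rightarrow> real) \<Rightarrow> 's set" where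
  "argmin_on A f = {s. is_arg_min f (\<lambda>s. s \<in> A) s}"

(* The players are 1, ..., n; the groups are {1..m} and {m+1..n}. The strategy sets S and S' of
   the two groups may lie in different spaces, so a profile is a pair (x, y), where x gives the
   strategies of {1..m} and y those of {m+1..n}. Since x and y are extensional (PiE), the
   product topology on functions from nat restricts to the finite product topology. *)
locale two_group_game =
  fixes n m :: nat
    and S :: "'a::topological_vector_space set"
    and S' :: "'b::topological_vector_space set"
    and u :: "nat \<Rightarrow> (nat \<Rightarrow> 'a) \<Rightarrow> (nat \<Rightarrow> 'b) \<Rightarrow> real"
  assumes players: "n \<ge> 4" "2 \<le> m" "m \<le> n - 2"
    and strategies: "S \<noteq> {}" "convex S" "compact S"
    and strategies': "S' \<noteq> {}" "convex S'" "compact S'"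
    and continuous_payoff: "\<And>i. i \<in> {1..n} \<Longrightarrow>
      continuous_on (({1..m} \<rightarrow>\<^sub>E S) \<times> ({m+1..n} \<rightarrow>\<^sub>E S')) (\<lambda>(x, y). u i x y)"
    and quasi_concave: "\<And>i x y. i \<in> {1..m} \<Longrightarrow> x \<in> {1..m} \<rightarrow>\<^sub>E S \<Longrightarrow> y \<in> {m+1..n} \<rightarrow>\<^sub>E S' \<Longrightarrow>
      quasi_concave_on S (\<lambda>s. u i (x(i := s)) y)"
    and quasi_concave': "\<And>k x y. k \<in> {m+1..n} \<Longrightarrow> x \<in> {1..m} \<rightarrow>\<^sub>E S \<Longrightarrow> y \<in> {m+1..n} \<rightarrow>\<^sub>E S' \<Longrightarrow>
      quasi_concave_on S' (\<lambda>s. u k x (y(k := s)))"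
    and quasi_convex: "\<And>i j x y. i \<in> {1..n} \<Longrightarrow> j \<in> {1..m} \<Longrightarrow> j \<noteq> i \<Longrightarrow>
      x \<in> {1..m} \<rightarrow>\<^sub>E S \<Longrightarrow> y \<in> {m+1..n} \<rightarrow>\<^sub>E S' \<Longrightarrow>
      quasi_convex_on S (\<lambda>s. u i (x(j := s)) y)"
    and quasi_convex': "\<And>i l x y. i \<in> {1..n} \<Longrightarrow> l \<in> {m+1..n} \<Longrightarrow> l \<noteq> i \<Longrightarrow>
      x \<in> {1..m} \<rightarrow>\<^sub>E S \<Longrightarrow> y \<in> {m+1..n} \<rightarrow>\<^sub>E S' \<Longrightarrow>
      quasi_convex_on S' (\<lambda>s. u i x (y(l := s)))"
    and zero_sum: "\<And>x y. x \<in> {1..m} \<rightarrow>\<^sub>E S \<Longrightarrow> y \<in> {m+1..n} \<rightarrow>\<^sub>E S' \<Longrightarrow>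
      (\<Sum>i\<in>{1..m}. u i x y) = 0"
    and zero_sum': "\<And>x y. x \<in> {1..m} \<rightarrow>\<^sub>E S \<Longrightarrow> y \<in> {m+1..n} \<rightarrow>\<^sub>E S' \<Longrightarrow>
      (\<Sum>k\<in>{m+1..n}. u k x y) = 0"
    and symmetric: "\<And>\<pi> i x y. \<pi> permutes {1..n} \<Longrightarrow> \<pi> ` {1..m} = {1..m} \<Longrightarrow>
      \<pi> ` {m+1..n} = {m+1..n} \<Longrightarrow> i \<in> {1..n} \<Longrightarrow>
      x \<in> {1..m} \<rightarrow>\<^sub>E S \<Longrightarrow> y \<in> {m+1..n} \<rightarrow>\<^sub>E S' \<Longrightarrow>
      u (\<pi> i) x y = u i (x \<circ> \<pi>) (y \<circ> \<pi>)"
    and unique_maximin: "\<And>i j x y. i \<in> {1..m} \<Longrightarrow> j \<in> {1..m} \<Longrightarrow> i \<noteq> j \<Longrightarrow>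
      x \<in> {1..m} \<rightarrow>\<^sub>E S \<Longrightarrow> y \<in> {m+1..n} \<rightarrow>\<^sub>E S' \<Longrightarrow>
      is_singleton (argmax_on S (\<lambda>s. min_on S (\<lambda>t. u i (x(i := s, j := t)) y)))"
    and unique_minimax: "\<And>i j x y. i \<in> {1..m} \<Longrightarrow> j \<in> {1..m} \<Longrightarrow> i \<noteq> j \<Longrightarrow>
      x \<in> {1..m} \<rightarrow>\<^sub>E S \<Longrightarrow> y \<in> {m+1..n} \<rightarrow>\<^sub>E S' \<Longrightarrow>
      is_singleton (argmin_on S (\<lambda>t. max_on S (\<lambda>s. u i (x(i := s, j := t)) y)))"
    and unique_maximin': "\<And>k l x y. k \<in> {m+1..n} \<Longrightarrow> l \<in> {m+1..n} \<Longrightarrow> k \<noteq> l \<Longrightarrow>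
      x \<in> {1..m} \<rightarrow>\<^sub>E S \<Longrightarrow> y \<in> {m+1..n} \<rightarrow>\<^sub>E S' \<Longrightarrow>
      is_singleton (argmax_on S' (\<lambda>s. min_on S' (\<lambda>t. u k x (y(k := s, l := t)))))"
    and unique_minimax': "\<And>k l x y. k \<in> {m+1..n} \<Longrightarrow> l \<in> {m+1..n} \<Longrightarrow> k \<noteq> l \<Longrightarrow>
      x \<in> {1..m} \<rightarrow>\<^sub>E S \<Longrightarrow> y \<in> {m+1..n} \<rightarrow>\<^sub>E S' \<Longrightarrow>
      is_singleton (argmin_on S' (\<lambda>t. max_on S' (\<lambda>s. u k x (y(k := s, l := t)))))"
    and unique_best_response: "\<And>i x y. i \<in> {1..m} \<Longrightarrow>
      x \<in> {1..m} \<rightarrow>\<^sub>E S \<Longrightarrow> y \<in> {m+1..n} \<rightarrow>\<^sub>E S' \<Longrightarrow>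
      is_singleton (argmax_on S (\<lambda>s. u i (x(i := s)) y))"
    and unique_best_response': "\<And>k x y. k \<in> {m+1..n} \<Longrightarrow>
      x \<in> {1..m} \<rightarrow>\<^sub>E S \<Longrightarrow> y \<in> {m+1..n} \<rightarrow>\<^sub>E S' \<Longrightarrow>
      is_singleton (argmax_on S' (\<lambda>s. u k x (y(k := s))))"

definition nash_equilibrium ::
  "nat \<Rightarrow> nat \<Rightarrow> 'a set \<Rightarrow> 'b set \<Rightarrow> (nat \<Rightarrow> (nat \<Rightarrow> 'a) \<Rightarrow> (nat \<Rightarrow> 'b) \<Rightarrow> real) \<Rightarrow>
    (nat \<Rightarrow> 'a) \<Rightarrow> (nat \<Rightarrow> 'b) \<Rightarrow> bool" where
  "nash_equilibrium n m S S' u x y \<longleftrightarrow>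
     x \<in> {1..m} \<rightarrow>\<^sub>E S \<and> y \<in> {m+1..n} \<rightarrow>\<^sub>E S' \<and>
     (\<forall>i\<in>{1..m}. \<forall>s\<in>S. u i x y \<ge> u i (x(i := s)) y) \<and>
     (\<forall>k\<in>{m+1..n}. \<forall>s\<in>S'. u k x y \<ge> u k x (y(k := s)))"

(* The strategies of a group A all of whose members choose s. *)
definition all_choose :: "nat set \<Rightarrow> 's \<Rightarrow> nat \<Rightarrow> 's" where
  "all_choose A s = (\<lambda>i\<in>A. s)"

end

theory Submission
  imports Defs
begin

text \<open>If one player of a group deviates from the symmetric equilibrium, that player gains nothing,
  and the other members of the group all get the same payoff by symmetry. As the group is
  zero-sum, this payoff is nonnegative. So the equilibrium strategy is a saddle point of every
  two-player game inside the group. No minimax theorem is needed, and the uniqueness assumptions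
  identify the saddle point with the maximin and minimax strategies.\<close>

lemma max_on_eqI:
  assumes "a \<in> A" "\<And>s. s \<in> A \<Longrightarrow> f s \<le> f a"
  shows "max_on A f = f a"
  unfolding max_on_def using assms by (intro Greatest_equality) auto

lemma min_on_eqI:
  assumes "a \<in> A" "\<And>s. s \<in> A \<Longrightarrow> f a \<le> f s"
  shows "min_on A f = f a"
  unfolding min_on_def using assms by (intro Least_equality) auto

text \<open>Compactness and continuity ensure that the minimum is attained. Otherwise the
  \<open>LEAST\<close> behind \<open>min_on\<close> need not be a lower bound at all.\<close>

lemma min_on_le:
  fixes f :: "'s::topological_space \<Rightarrow> real"
  assumes "compact A" "continuous_on A f" "t \<in> A"
  shows "min_on A f \<le> f t"
proof -
  obtain a where "a \<in> A" "\<forall>s\<in>A. f a \<le> f s"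
    using continuous_attains_inf assms by (metis empty_iff)
  then show ?thesis using min_on_eqI[of a A f] assms(3) by simp
qed

lemma le_max_on:
  fixes f :: "'s::topological_space \<Rightarrow> real"
  assumes "compact A" "continuous_on A f" "t \<in> A"
  shows "f t \<le> max_on A f"
proof -
  obtain a where "a \<in> A" "\<forall>s\<in>A. f s \<le> f a"
    using continuous_attains_sup assms by (metis empty_iff)
  then show ?thesis using max_on_eqI[of a A f] assms(3) by simp
qed

lemma mem_argmax_on: "a \<in> argmax_on A f \<longleftrightarrow> a \<in> A \<and> (\<forall>s\<in>A. f s \<le> f a)"
  by (auto simp: argmax_on_def is_arg_max_def not_less)

lemma mem_argmin_on: "a \<in> argmin_on A f \<longleftrightarrow> a \<in> A \<and> (\<forall>s\<in>A. f a \<le> f s)"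
  by (auto simp: argmin_on_def is_arg_min_def not_less)

lemma is_singleton_eq: "is_singleton A \<Longrightarrow> a \<in> A \<Longrightarrow> A = {a}"
  by (auto simp: is_singleton_def)

text \<open>For every \<open>s\<close>, \<open>min_on A (f s)\<close> is at most
  \<open>f s a\<close>, which is at most \<open>f a a\<close>, and \<open>f a a\<close> equals
  \<open>min_on A (f a)\<close>. Hence \<open>a\<close> maximises the inner minimum. The dual chain
  shows that \<open>a\<close> minimises the inner maximum, and both outer extrema equal
  \<open>f a a\<close>.\<close>

lemma saddle_point_minimax:
  fixes f :: "'s::topological_space \<Rightarrow> 's \<Rightarrow> real"
  assumes A: "compact A" "a \<in> A"
    and cont1: "\<And>t. t \<in> A \<Longrightarrow> continuous_on A (\<lambda>s. f s t)"
    and cont2: "\<And>s. s \<in> A \<Longrightarrow> continuous_on A (f s)"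
    and saddle: "\<And>s. s \<in> A \<Longrightarrow> f s a \<le> f a a" "\<And>t. t \<in> A \<Longrightarrow> f a a \<le> f a t"
  shows "max_on A (\<lambda>s. min_on A (f s)) = min_on A (\<lambda>t. max_on A (\<lambda>s. f s t))"
    and "a \<in> argmax_on A (\<lambda>s. min_on A (f s))"
    and "a \<in> argmin_on A (\<lambda>t. max_on A (\<lambda>s. f s t))"
proof -
  have min_a: "min_on A (f a) = f a a" and max_a: "max_on A (\<lambda>s. f s a) = f a a"
    using min_on_eqI[of a A "f a"] max_on_eqI[of a A "\<lambda>s. f s a"] A saddle by auto
  have min_le: "min_on A (f s) \<le> min_on A (f a)" if "s \<in> A" for s
    using min_on_le[OF A(1) cont2[OF that] A(2)] saddle(1)[OF that] min_a by simp
  have max_ge: "max_on A (\<lambda>s. f s a) \<le> max_on A (\<lambda>s. f s t)" if "t \<in> A" for t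
    using le_max_on[OF A(1) cont1[OF that] A(2)] saddle(2)[OF that] max_a by simp
  show "max_on A (\<lambda>s. min_on A (f s)) = min_on A (\<lambda>t. max_on A (\<lambda>s. f s t))"
    using max_on_eqI[of a A "\<lambda>s. min_on A (f s)"] min_on_eqI[of a A "\<lambda>t. max_on A (\<lambda>s. f s t)"]
      A min_le max_ge min_a max_a by simp
  show "a \<in> argmax_on A (\<lambda>s. min_on A (f s))"
    and "a \<in> argmin_on A (\<lambda>t. max_on A (\<lambda>s. f s t))"
    using A min_le max_ge by (auto simp: mem_argmax_on mem_argmin_on)
qed

text \<open>In the product topology continuity is checked coordinatewise: coordinate
  \<open>i\<close> is \<open>h\<close>, and every other coordinate comes from
  \<open>g\<close>.\<close>

lemma continuous_on_fun_upd:
  fixes g :: "'t::topological_space \<Rightarrow> 'i \<Rightarrow> 's::topological_space"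
  assumes "continuous_on A g" "continuous_on A h"
  shows "continuous_on A (\<lambda>t. (g t)(i := h t))"
proof (rule continuous_on_coordinatewise_then_product)
  show "continuous_on A (\<lambda>t. ((g t)(i := h t)) j)" for j
    using assms by (cases "j = i") (auto intro: continuous_on_product_then_coordinatewise)
qed

lemma all_choose_PiE: "a \<in> A \<Longrightarrow> all_choose G a \<in> G \<rightarrow>\<^sub>E A"
  by (auto simp: all_choose_def)

lemma fun_upd_PiE: "x \<in> G \<rightarrow>\<^sub>E A \<Longrightarrow> i \<in> G \<Longrightarrow> s \<in> A \<Longrightarrow> x(i := s) \<in> G \<rightarrow>\<^sub>E A"
  by (auto simp: PiE_iff extensional_def)

text \<open>This yields the half of the saddle property that the equilibrium condition does not
  state: a deviation by the opponent \<open>j\<close> cannot hurt \<open>i\<close>. Only one group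
  appears; the strategies of the other group are meant to be frozen inside \<open>v\<close>.\<close>

lemma deviation_benefits_others:
  fixes v :: "nat \<Rightarrow> (nat \<Rightarrow> 's) \<Rightarrow> real"
  assumes G: "finite G" "i \<in> G" "j \<in> G" "i \<noteq> j" and S: "a \<in> S" "t \<in> S"
    and zero: "\<And>x. x \<in> G \<rightarrow>\<^sub>E S \<Longrightarrow> (\<Sum>p\<in>G. v p x) = 0"
    and sym: "\<And>p q x. p \<in> G \<Longrightarrow> q \<in> G \<Longrightarrow> x \<in> G \<rightarrow>\<^sub>E S \<Longrightarrow>
      v q x = v p (x \<circ> Transposition.transpose p q)"
    and nash: "\<And>p s. p \<in> G \<Longrightarrow> s \<in> S \<Longrightarrow> v p ((all_choose G a)(p := s)) \<le> v p (all_choose G a)"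
  shows "v i (all_choose G a) \<le> v i ((all_choose G a)(j := t))"
proof -
  define x where "x = all_choose G a"
  define z where "z = x(j := t)"
  have xP: "x \<in> G \<rightarrow>\<^sub>E S" and zP: "z \<in> G \<rightarrow>\<^sub>E S"
    unfolding z_def x_def using G S by (simp_all add: all_choose_PiE fun_upd_PiE)
  have eqx: "v p x = v i x" if "p \<in> G" for p
  proof -
    have "x \<circ> Transposition.transpose i p = x"
      using that G by (auto simp: x_def all_choose_def fun_eq_iff Transposition.transpose_def)
    then show ?thesis using sym[OF G(2) that xP] by simp
  qed
  have eqz: "v p z = v i z" if "p \<in> G - {j}" for p
  proof -
    \<comment> \<open>The profile \<open>z\<close> is constant on \<open>G\<close> except at
      \<open>j\<close>. Since \<open>i\<close> and \<open>p\<close> both differ from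
      \<open>j\<close>, swapping them does not affect \<open>z\<close>.\<close>
    have "z \<circ> Transposition.transpose i p = z"
      using that G
      by (auto simp: z_def x_def all_choose_def fun_eq_iff Transposition.transpose_def)
    then show ?thesis using sym[OF G(2) _ zP, of p] that by simp
  qed
  have "(\<Sum>p\<in>G. v p x) = real (card G) * v i x"
    using eqx by simp
  \<comment> \<open>\<open>G\<close> is nonempty, so the factor \<open>card G\<close> can be
    cancelled.\<close>
  then have x0: "v i x = 0"
    using zero[OF xP] G by auto
  have "(\<Sum>p\<in>G. v p z) = v j z + (\<Sum>p\<in>G - {j}. v p z)"
    using G(1,3) by (rule sum.remove)
  also have "(\<Sum>p\<in>G - {j}. v p z) = real (card (G - {j})) * v i z"
    using eqz by simp
  \<comment> \<open>The members of \<open>G - {j}\<close> share \<open>- v j z\<close> equally. This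
    amount is nonnegative, because deviating cannot lift \<open>j\<close> above the equilibrium
    payoff 0, and \<open>i\<close> is among those who share it.\<close>
  finally have "real (card (G - {j})) * v i z = - v j z"
    using zero[OF zP] by simp
  moreover have "v j z \<le> 0"
    using nash[OF G(3) S(2)] eqx[OF G(3)] x0 by (simp add: z_def x_def)
  moreover have "0 < card (G - {j})"
    unfolding card_gt_0_iff using G by blast
  ultimately have "0 \<le> v i z"
    by (metis neg_0_le_iff_le of_nat_0_less_iff zero_le_mult_iff not_le)
  then show ?thesis using x0 by (simp add: z_def x_def)
qed

text \<open>Stating the result for an arbitrary index set \<open>G\<close> and payoffs
  \<open>v\<close> of a single profile lets it serve both groups, although their strategies have
  different types.\<close>

lemma symmetric_equilibrium_minimax:
  fixes v :: "nat \<Rightarrow> (nat \<Rightarrow> 's::topological_space) \<Rightarrow> real"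
  defines "f \<equiv> \<lambda>G a i j s t. v i ((all_choose G a)(i := s, j := t))"
  assumes G: "finite G" "i \<in> G" "j \<in> G" "i \<noteq> j" and S: "compact S" "a \<in> S"
    and cont: "continuous_on (G \<rightarrow>\<^sub>E S) (v i)"
    and zero: "\<And>x. x \<in> G \<rightarrow>\<^sub>E S \<Longrightarrow> (\<Sum>p\<in>G. v p x) = 0"
    and sym: "\<And>p q x. p \<in> G \<Longrightarrow> q \<in> G \<Longrightarrow> x \<in> G \<rightarrow>\<^sub>E S \<Longrightarrow>
      v q x = v p (x \<circ> Transposition.transpose p q)"
    and nash: "\<And>p s. p \<in> G \<Longrightarrow> s \<in> S \<Longrightarrow> v p ((all_choose G a)(p := s)) \<le> v p (all_choose G a)"
    and unique: "is_singleton (argmax_on S (\<lambda>s. min_on S (f G a i j s)))"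
      "is_singleton (argmin_on S (\<lambda>t. max_on S (\<lambda>s. f G a i j s t)))"
  shows "max_on S (\<lambda>s. min_on S (f G a i j s)) = min_on S (\<lambda>t. max_on S (\<lambda>s. f G a i j s t)) \<and>
    argmax_on S (\<lambda>s. min_on S (f G a i j s)) = {a} \<and>
    argmin_on S (\<lambda>t. max_on S (\<lambda>s. f G a i j s t)) = {a}"
proof -
  let ?x = "all_choose G a"
  have P: "?x(i := s, j := t) \<in> G \<rightarrow>\<^sub>E S" if "s \<in> S" "t \<in> S" for s t
    using that G S by (intro fun_upd_PiE all_choose_PiE)
  have cont1: "continuous_on S (\<lambda>s. f G a i j s t)" if "t \<in> S" for t
    unfolding f_def using that P
    by (intro continuous_on_compose2[OF cont] continuous_on_fun_upd continuous_intros) auto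
  have cont2: "continuous_on S (f G a i j s)" if "s \<in> S" for s
    unfolding f_def using that P
    by (intro continuous_on_compose2[OF cont] continuous_on_fun_upd continuous_intros) auto
  \<comment> \<open>Resetting a player to \<open>a\<close> changes nothing. So
    \<open>f G a i j s a\<close> is a deviation by \<open>i\<close> alone, once the two updates are
    commuted, and \<open>f G a i j a t\<close> is a deviation by \<open>j\<close> alone.\<close>
  have upd: "?x(i := a) = ?x" "?x(j := a) = ?x"
    using G by (auto simp: all_choose_def)
  have saddle1: "f G a i j s a \<le> f G a i j a a" if "s \<in> S" for s
    using nash[OF G(2) that] upd fun_upd_twist[OF G(4), of ?x s a] by (simp add: f_def)
  have saddle2: "f G a i j a a \<le> f G a i j a t" if "t \<in> S" for t
    unfolding f_def upd by (rule deviation_benefits_others) (fact G S that zero sym nash)+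
  show ?thesis
  proof (intro conjI is_singleton_eq unique)
    show "max_on S (\<lambda>s. min_on S (f G a i j s)) = min_on S (\<lambda>t. max_on S (\<lambda>s. f G a i j s t))"
      and "a \<in> argmax_on S (\<lambda>s. min_on S (f G a i j s))"
      and "a \<in> argmin_on S (\<lambda>t. max_on S (\<lambda>s. f G a i j s t))"
      by (rule saddle_point_minimax; fact S cont1 cont2 saddle1 saddle2)+
  qed
qed

lemma all_choose_transpose:
  "p \<notin> G \<Longrightarrow> q \<notin> G \<Longrightarrow> all_choose G a \<circ> Transposition.transpose p q = all_choose G a"
  by (auto simp: all_choose_def fun_eq_iff Transposition.transpose_def)

theorem theorem1:
  fixes n m :: nat
    and S :: "'a::topological_vector_space set"
    and S' :: "'b::topological_vector_space set"
    and u :: "nat \<Rightarrow> (nat \<Rightarrow> 'a) \<Rightarrow> (nat \<Rightarrow> 'b) \<Rightarrow> real"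
  assumes game: "two_group_game n m S S' u"
    and equilibrium: "\<exists>s\<in>S. \<exists>s'\<in>S'.
      nash_equilibrium n m S S' u (all_choose {1..m} s) (all_choose {m+1..n} s')"
  shows "\<exists>a\<in>S. \<exists>b\<in>S'. \<forall>i\<in>{1..m}. \<forall>j\<in>{1..m}. \<forall>k\<in>{m+1..n}. \<forall>l\<in>{m+1..n}.
    i \<noteq> j \<longrightarrow> k \<noteq> l \<longrightarrow>
    (let x = all_choose {1..m} a;
         y = all_choose {m+1..n} b;
         f = (\<lambda>s t. u i (x(i := s, j := t)) y);
         g = (\<lambda>s t. u k x (y(k := s, l := t)))
     in max_on S (\<lambda>s. min_on S (\<lambda>t. f s t)) = min_on S (\<lambda>t. max_on S (\<lambda>s. f s t)) \<and>
        argmax_on S (\<lambda>s. min_on S (\<lambda>t. f s t)) = {a} \<and>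
        argmin_on S (\<lambda>t. max_on S (\<lambda>s. f s t)) = {a} \<and>
        max_on S' (\<lambda>s. min_on S' (\<lambda>t. g s t)) = min_on S' (\<lambda>t. max_on S' (\<lambda>s. g s t)) \<and>
        argmax_on S' (\<lambda>s. min_on S' (\<lambda>t. g s t)) = {b} \<and>
        argmin_on S' (\<lambda>t. max_on S' (\<lambda>s. g s t)) = {b})"
proof -
  interpret two_group_game n m S S' u by (rule game)
  \<comment> \<open>The equilibrium strategies themselves are the witnesses for both groups.\<close>
  obtain a b where ab: "a \<in> S" "b \<in> S'"
    and nash: "nash_equilibrium n m S S' u (all_choose {1..m} a) (all_choose {m+1..n} b)"
    using equilibrium by blast
  define x where "x = all_choose {1..m} a"
  define y where "y = all_choose {m+1..n} b"
  have xP: "x \<in> {1..m} \<rightarrow>\<^sub>E S" and yP: "y \<in> {m+1..n} \<rightarrow>\<^sub>E S'"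
    unfolding x_def y_def using ab by (simp_all add: all_choose_PiE)
  have mn: "m \<le> n" using players by linarith
  \<comment> \<open>A swap of two members of one group preserves both groups, so it is among the
    permutations covered by \<open>symmetric\<close>.\<close>
  have trans: "Transposition.transpose p q permutes {1..n}"
    "Transposition.transpose p q ` {1..m} = {1..m}"
    "Transposition.transpose p q ` {m+1..n} = {m+1..n}"
    if "p \<in> {1..m} \<and> q \<in> {1..m} \<or> p \<in> {m+1..n} \<and> q \<in> {m+1..n}" for p q
  proof -
    have in_n: "p \<in> {1..n}" "q \<in> {1..n}" using that mn by auto
    show "Transposition.transpose p q permutes {1..n}"
      using in_n by (rule permutes_swap_id)
    show "Transposition.transpose p q ` {1..m} = {1..m}"
      "Transposition.transpose p q ` {m+1..n} = {m+1..n}"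
      by (rule transpose_image_eq; use that in auto)+
  qed
  have group1: "max_on S (\<lambda>s. min_on S (\<lambda>t. u i (x(i := s, j := t)) y)) =
        min_on S (\<lambda>t. max_on S (\<lambda>s. u i (x(i := s, j := t)) y)) \<and>
      argmax_on S (\<lambda>s. min_on S (\<lambda>t. u i (x(i := s, j := t)) y)) = {a} \<and>
      argmin_on S (\<lambda>t. max_on S (\<lambda>s. u i (x(i := s, j := t)) y)) = {a}"
    if ij: "i \<in> {1..m}" "j \<in> {1..m}" "i \<noteq> j" for i j
    unfolding x_def
  \<comment> \<open>With \<open>y\<close> frozen at its equilibrium value, the payoffs of the first
    group form a zero-sum symmetric game in \<open>x\<close> alone, and
    \<open>all_choose {1..m} a\<close> is an equilibrium of it.\<close>
  proof (rule symmetric_equilibrium_minimax[where v = "\<lambda>i x. u i x y"])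
    show "continuous_on ({1..m} \<rightarrow>\<^sub>E S) (\<lambda>x. u i x y)"
      using continuous_on_compose2[OF continuous_payoff[of i], of "{1..m} \<rightarrow>\<^sub>E S" "\<lambda>x. (x, y)"]
        ij mn yP by (force intro: continuous_on_Pair continuous_on_const continuous_on_id)
    show "u q z y = u p (z \<circ> Transposition.transpose p q) y"
      if "p \<in> {1..m}" "q \<in> {1..m}" "z \<in> {1..m} \<rightarrow>\<^sub>E S" for p q z
      using symmetric[OF trans[of p q] _ that(3) yP, of p] that mn
        all_choose_transpose[of p "{m+1..n}" q b] by (simp add: y_def)
  qed (use ij ab strategies zero_sum[OF _ yP] nash unique_maximin[OF ij xP yP]
      unique_minimax[OF ij xP yP] in \<open>auto simp: nash_equilibrium_def x_def y_def\<close>)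
  have group2: "max_on S' (\<lambda>s. min_on S' (\<lambda>t. u k x (y(k := s, l := t)))) =
        min_on S' (\<lambda>t. max_on S' (\<lambda>s. u k x (y(k := s, l := t)))) \<and>
      argmax_on S' (\<lambda>s. min_on S' (\<lambda>t. u k x (y(k := s, l := t)))) = {b} \<and>
      argmin_on S' (\<lambda>t. max_on S' (\<lambda>s. u k x (y(k := s, l := t)))) = {b}"
    if kl: "k \<in> {m+1..n}" "l \<in> {m+1..n}" "k \<noteq> l" for k l
    unfolding y_def
  \<comment> \<open>The roles are exchanged: now \<open>x\<close> is frozen and the second group
    plays.\<close>
  proof (rule symmetric_equilibrium_minimax[where v = "\<lambda>k. u k x"])
    show "continuous_on ({m+1..n} \<rightarrow>\<^sub>E S') (u k x)"
      using continuous_on_compose2[OF continuous_payoff[of k], of "{m+1..n} \<rightarrow>\<^sub>E S'" "\<lambda>y. (x, y)"]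
        kl xP by (force intro: continuous_on_Pair continuous_on_const continuous_on_id)
    show "u q x z = u p x (z \<circ> Transposition.transpose p q)"
      if "p \<in> {m+1..n}" "q \<in> {m+1..n}" "z \<in> {m+1..n} \<rightarrow>\<^sub>E S'" for p q z
      using symmetric[OF trans[of p q] _ xP that(3), of p] that
        all_choose_transpose[of p "{1..m}" q a] by (simp add: x_def)
  qed (use kl ab strategies' zero_sum'[OF xP] nash unique_maximin'[OF kl xP yP]
      unique_minimax'[OF kl xP yP] in \<open>auto simp: nash_equilibrium_def x_def y_def\<close>)
  show ?thesis
    unfolding Let_def
    using ab group1 group2 unfolding x_def y_def by blast
qed

end
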